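(* Let $m\ge 1$ be an integer, let $x_1,\dots,x_m$ be elements of a commutative ring, and let $A_m(x_1,\dots,x_m)$ be the $m\times m$ matrix whose $(p,q)$ entry is $x_{m+1-\min(p,q)}$ for $1\le p,q\le m$. Then $$\det(A_m(x_1,\dots,x_m))=\prod_{i=1}^{m}(x_i-x_{i+1}),\qquad\text{where } x_{m+1}=0.$$
   Context: The matrix is, explicitly, $$A_m(x_1,\dots,x_m)=\begin{pmatrix} x_m & x_m & \cdots & x_m & x_m\\ x_m & x_{m-1} & \cdots & x_{m-1} & x_{m-1}\\ \vdots&\vdots&\ddots&\vdots&\vdots\\ x_m & x_{m-1} & \cdots & x_2 & x_2\\ x_m & x_{m-1}&\cdots & x_2 & x_1\end{pmatrix}.$$ *)

theory Defs
  imports "Jordan_Normal_Form.Determinant"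
begin

(* Rows and columns of a matrix are numbered from 0 in the library, so the (i, j) entry here
   is the entry with p = i + 1 and q = j + 1 in the usual numbering. The family x_1, ..., x_m
   is a function on nat of which only the values at 1, ..., m are used. *)
definition A_mat :: "nat \<Rightarrow> (nat \<Rightarrow> 'a) \<Rightarrow> 'a mat" where
  "A_mat m x = mat m m (\<lambda>(i, j). x (m + 1 - min (i + 1) (j + 1)))"

end

theory Submission
  imports Defs
begin

text \<open>
  The matrix \<open>A\<^sub>m\<close> has the form \<open>(a (min i j))\<close>, and such a matrix factors as \<open>L * U\<close>, where \<open>L\<close> is the
  lower triangular matrix of ones and row \<open>k\<close> of the upper triangular matrix \<open>U\<close> is constantly
  \<open>a k - a (k - 1)\<close> from the diagonal on: the entry \<open>(i, j)\<close> of the product telescopes to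
  \<open>a (min i j)\<close>. The determinant is therefore the product of these differences.
\<close>

lemma det_mat_min:
  fixes a :: "nat \<Rightarrow> 'a :: comm_ring_1"
  shows "det (mat n n (\<lambda>(i, j). a (min i j))) =
    (\<Prod>k<n. a k - (if k = 0 then 0 else a (k - 1)))"
proof -
  \<comment> \<open>The case split makes \<open>d 0 = a 0\<close>; truncated subtraction would turn
    \<open>a 0 - a (0 - 1)\<close> into 0.\<close>
  define d where "d k = a k - (if k = 0 then 0 else a (k - 1))" for k
  define L :: "'a mat" where "L = mat n n (\<lambda>(i, k). if k \<le> i then 1 else 0)"
  define U where "U = mat n n (\<lambda>(k, j). if k \<le> j then d k else 0)"
  have L: "L \<in> carrier_mat n n" and U: "U \<in> carrier_mat n n"
    by (simp_all add: L_def U_def)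
  have telescope: "(\<Sum>k\<le>r. d k) = a r" for r
    by (induction r) (simp_all add: d_def)
  have "mat n n (\<lambda>(i, j). a (min i j)) = L * U"
  proof (rule eq_matI)
    fix i j assume "i < dim_row (L * U)" "j < dim_col (L * U)"
    then have ij: "i < n" "j < n" using L U by auto
    \<comment> \<open>\<open>L\<close> requires \<open>k \<le> i\<close> and \<open>U\<close>
      requires \<open>k \<le> j\<close>, so only \<open>k \<le> min i j\<close> contributes.\<close>
    have "(L * U) $$ (i, j) = (\<Sum>k\<in>{0..<n}. if k \<le> min i j then d k else 0)"
      using ij by (auto simp: L_def U_def scalar_prod_def intro!: sum.cong)
    also have "\<dots> = (\<Sum>k\<le>min i j. d k)"
      using ij by (intro sum.mono_neutral_cong_right) auto
    finally show "mat n n (\<lambda>(i, j). a (min i j)) $$ (i, j) = (L * U) $$ (i, j)"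
      using ij by (simp add: telescope)
  qed (use L U in auto)
  moreover have "det L = 1"
    by (subst det_lower_triangular[OF _ L]) (auto simp: L_def prod_list_diag_prod)
  moreover have "det U = (\<Prod>k<n. d k)"
    by (subst det_upper_triangular[OF _ U])
      (auto simp: U_def prod_list_diag_prod upper_triangular_def lessThan_atLeast0)
  ultimately show ?thesis
    using det_mult[OF L U] by (simp add: d_def)
qed

theorem proposition1p1:
  fixes m :: nat and x :: "nat \<Rightarrow> 'a :: comm_ring_1"
  assumes "m \<ge> 1"
  shows "det (A_mat m x) = (\<Prod>i = 1..m. x i - (if i = m then 0 else x (i + 1)))"
proof -
  have "A_mat m x = mat m m (\<lambda>(i, j). x (m - min i j))"
    unfolding A_mat_def by (rule eq_matI) (auto simp: min_def)
  then have "det (A_mat m x) = (\<Prod>k<m. x (m - k) - (if k = 0 then 0 else x (m - (k - 1))))"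
    using det_mat_min[of m "\<lambda>k. x (m - k)"] by simp
  \<comment> \<open>Reversal \<open>i = m - k\<close>: the boundary factor \<open>k = 0\<close>
    becomes \<open>i = m\<close>, where x_{m+1} = 0, and for \<open>k > 0\<close> the index
    \<open>m - (k - 1)\<close> is \<open>i + 1\<close>.\<close>
  also have "\<dots> = (\<Prod>i = 1..m. x i - (if i = m then 0 else x (i + 1)))"
    by (rule prod.reindex_bij_witness[where i = "\<lambda>i. m - i" and j = "\<lambda>k. m - k"])
      (auto simp: Suc_diff_le)
  finally show ?thesis .
qed

end
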